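(* Let $P,Q\in\mathbb{Z}$ with $PQ\neq 0$, let $p$ be a prime with $p\nmid\gcd(P,Q)$, and let $r\geq 1$ be an integer. Then \[ \mathcal{L}(P,Q,p^{-r})= \begin{cases} \{0\} & \text{if } p\mid Q,\\ \langle p^{(r-\nu)_+}\rho\rangle & \text{if } p\geq 3 \text{ and } p\nmid Q,\\ \langle 2^{1+(r-\nu_2(P))_+}\rangle & \text{if } p=2\mid P \text{ and } 2\nmid Q,\\ \langle 3\cdot 2^{(r-\nu_2(U_3))_+}\rangle & \text{if } p=2,\ 2\nmid P,\ 2\nmid Q,\ Q\equiv 1 \pmod 4,\\ \langle 3\rangle & \text{if } p=2,\ 2\nmid P,\ 2\nmid Q,\ Q\equiv -1 \pmod 4,\ r=1,\\ \langle 6\cdot 2^{(r-\nu_2(U_6))_+}\rangle & \text{if } p=2,\ 2\nmid P,\ 2\nmid Q,\ Q\equiv -1 \pmod 4,\ r\neq 1. \end{cases} \]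
   Context: $\mathbb{N}=\{0,1,2,\ldots\}$. For $P,Q\in\mathbb{Z}$, the Lucas sequence $U_n=U_n(P,Q)$ is defined by $U_0=0$, $U_1=1$, $U_{n+2}=PU_{n+1}-QU_n$. For $R\in\mathbb{Q}$, $\mathcal{L}(P,Q,R)=\{n\in\mathbb{N} : U_nR\in\mathbb{Z}\}$; so $\mathcal{L}(P,Q,p^{-r})=\{n:\nu_p(U_n)\geq r\}$, where $\nu_p$ is the $p$-adic valuation. $\langle\cdot\rangle$ denotes the generated additive subsemigroup of $\mathbb{N}$. $(x)_+=\max\{x,0\}$. When $p\nmid Q$, the rank of appearance $\rho=\rho(p)$ of $p$ in $U_n$ is the least integer $\rho\geq 2$ with $p\mid U_\rho$ (it exists), and the rank exponent is $\nu=\nu_p(U_\rho)$. *)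

theory Defs
  imports "HOL-Number_Theory.Number_Theory" "HOL-Library.Extended_Nat"
begin

fun lucas_U :: "int \<Rightarrow> int \<Rightarrow> nat \<Rightarrow> int" where
  "lucas_U P Q 0 = 0"
| "lucas_U P Q (Suc 0) = 1"
| "lucas_U P Q (Suc (Suc n)) = P * lucas_U P Q (Suc n) - Q * lucas_U P Q n"

definition lucas_set :: "int \<Rightarrow> int \<Rightarrow> rat \<Rightarrow> nat set" where
  "lucas_set P Q R = {n. of_int (lucas_U P Q n) * R \<in> \<int>}"

text \<open>Subsemigroups of the natural numbers are taken to contain 0, as numerical
  semigroups do; in particular the one generated by \<open>x\<close> is \<open>{0, x, 2x, \<dots>}\<close>.\<close>

definition add_semigroup :: "nat set \<Rightarrow> bool" where
  "add_semigroup S \<longleftrightarrow> 0 \<in> S \<and> (\<forall>a\<in>S. \<forall>b\<in>S. a + b \<in> S)"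

definition generated_semigroup :: "nat set \<Rightarrow> nat set" where
  "generated_semigroup A = add_semigroup hull A"

text \<open>Terms with positive index of a degenerate Lucas sequence may vanish (for instance
  \<open>U\<^sub>3(1, 1) = 0\<close>), so the valuation must take the value \<open>\<infinity>\<close> at 0,
  whereas \<^const>\<open>multiplicity\<close> is 0 there.\<close>

definition val :: "nat \<Rightarrow> int \<Rightarrow> enat" where
  "val p x = (if x = 0 then \<infinity> else enat (multiplicity (int p) x))"

text \<open>The positive part of \<open>r - v\<close>: subtraction on \<^typ>\<open>enat\<close> is truncated at 0,
  and \<open>enat r - \<infinity> = 0\<close>.\<close>

definition pos_diff :: "nat \<Rightarrow> enat \<Rightarrow> nat" where
  "pos_diff r v = the_enat (enat r - v)"

text \<open>Only meaningful when \<open>p\<close> does not divide \<open>Q\<close>, in which case such an index exists.\<close>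

definition rank_of_appearance :: "int \<Rightarrow> int \<Rightarrow> nat \<Rightarrow> nat" where
  "rank_of_appearance P Q p = (LEAST n. 2 \<le> n \<and> int p dvd lucas_U P Q n)"

definition rank_exponent :: "int \<Rightarrow> int \<Rightarrow> nat \<Rightarrow> enat" where
  "rank_exponent P Q p = val p (lucas_U P Q (rank_of_appearance P Q p))"

end

theory Submission
  imports Defs
begin

text \<open>
  If \<open>\<alpha>\<close> is a root of \<open>x\<^sup>2 - P x + Q\<close>, then \<open>\<alpha>\<^sup>n = a + U\<^sub>n \<alpha>\<close> with \<open>a = U\<^sub>n\<^sub>+\<^sub>1 - P U\<^sub>n\<close>.
  Expanding \<open>(a + U\<^sub>n \<alpha>)\<^sup>k\<close> up to the third power of \<open>u = U\<^sub>n\<close> gives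
  \<open>U\<^sub>k\<^sub>n \<equiv> k a\<^sup>k\<^sup>-\<^sup>1 u + (k choose 2) a\<^sup>k\<^sup>-\<^sup>2 u\<^sup>2 P\<close> modulo \<open>u\<^sup>3\<close>.
  Suppose \<open>p\<close> divides \<open>u\<close> but not \<open>Q\<close>; then \<open>p\<close> does not divide \<open>a\<close>, and so passing from \<open>n\<close> to
  \<open>k n\<close> leaves the valuation unchanged if \<open>p\<close> does not divide \<open>k\<close>, and raises it by exactly one if
  \<open>k = p\<close>, provided that \<open>p\<close> divides \<open>(p choose 2) u P / p\<close>: this holds if \<open>p\<close> is odd, \<open>P\<close> is even or
  \<open>4\<close> divides \<open>u\<close>. It remains to start from a suitable index \<open>n\<close>: the rank of appearance, or \<open>2\<close>,
  \<open>3\<close> or \<open>6\<close> for \<open>p = 2\<close>.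
\<close>

section \<open>Addition formula and divisibility by a prime\<close>

lemma lucas_U_add_Suc:
  "lucas_U P Q (Suc (m + n)) =
    lucas_U P Q (Suc m) * lucas_U P Q (Suc n) - Q * lucas_U P Q m * lucas_U P Q n"
proof (induction P Q m rule: lucas_U.induct)
  case (3 P Q m)
  have "lucas_U P Q (Suc (Suc (Suc m) + n)) =
      P * lucas_U P Q (Suc (Suc m + n)) - Q * lucas_U P Q (Suc (m + n))" by simp
  then show ?case unfolding 3 by (simp add: algebra_simps)
qed simp_all

text \<open>Compares the coefficients of \<alpha> in
  \<open>\<alpha>^(m + n) = \<alpha>^m * \<alpha>^n\<close>.\<close>

lemma lucas_U_add:
  "lucas_U P Q (m + n) =
    lucas_U P Q m * lucas_U P Q (Suc n) + lucas_U P Q n * (lucas_U P Q (Suc m) - P * lucas_U P Q m)"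
proof (cases m)
  case (Suc k)
  then show ?thesis
    using lucas_U_add_Suc[of P Q k n] by (simp add: algebra_simps)
qed simp

text \<open>Two consecutive multiples of \<open>p\<close> would propagate down the recurrence,
  \<open>Q\<close> being a unit modulo \<open>p\<close>, to \<open>U_1 = 1\<close>.\<close>

lemma prime_not_dvd_consecutive_lucas_U:
  assumes "prime p" "\<not> p dvd Q" "p dvd lucas_U P Q n"
  shows "\<not> p dvd lucas_U P Q (Suc n)"
  using assms(3)
proof (induction n)
  case 0
  then show ?case using assms(1) not_prime_unit by auto
next
  case (Suc n)
  show ?case
  proof
    assume "p dvd lucas_U P Q (Suc (Suc n))"
    then have "p dvd Q * lucas_U P Q n"
      using Suc.prems by (metis dvd_mult lucas_U.simps(3) dvd_diff_right_iff)
    then show False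
      using Suc assms prime_dvd_mult_iff by blast
  qed
qed

text \<open>Modulo \<open>p\<close>, adding \<open>n\<close> to the index multiplies a term by the
  unit \<open>lucas_U P Q (Suc n)\<close>, so the zeros have period \<open>n\<close>.\<close>

lemma prime_dvd_lucas_U_mod:
  assumes "prime p" "\<not> p dvd Q" "p dvd lucas_U P Q n"
  shows "p dvd lucas_U P Q i \<longleftrightarrow> p dvd lucas_U P Q (i mod n)"
proof -
  have step: "p dvd lucas_U P Q (m + n) \<longleftrightarrow> p dvd lucas_U P Q m" for m
    using assms prime_not_dvd_consecutive_lucas_U[OF assms]
    by (simp add: lucas_U_add dvd_add_left_iff prime_dvd_mult_iff)
  have "p dvd lucas_U P Q (m + k * n) \<longleftrightarrow> p dvd lucas_U P Q m" for m k
  proof (induction k)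
    case (Suc k)
    then show ?case using step[of "m + k * n"] by (simp add: algebra_simps)
  qed simp
  from this[of "i mod n" "i div n"] show ?thesis by simp
qed

text \<open>Pigeonhole on pairs of consecutive residues. As \<open>Q\<close> is a unit modulo
  \<open>p\<close>, the recurrence also runs backwards, which moves a repetition down to index
  0.\<close>

lemma exists_prime_dvd_lucas_U:
  assumes "prime (int p)" "\<not> int p dvd Q"
  shows "\<exists>n\<ge>2. int p dvd lucas_U P Q n"
proof -
  define s where "s n = (lucas_U P Q n mod int p, lucas_U P Q (Suc n) mod int p)" for n
  have "range s \<subseteq> {0..<int p} \<times> {0..<int p}"
    using prime_gt_0_int[OF assms(1)] by (auto simp: s_def)
  then have "finite (range s)" by (rule finite_subset) simp
  then have "\<not> inj s" using finite_imageD infinite_UNIV_nat by blast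
  then obtain i d where "s i = s (i + d)" "d > 0"
    unfolding inj_def by (metis less_imp_add_positive linorder_neqE_nat)
  then have "[lucas_U P Q i = lucas_U P Q (i + d)] (mod int p) \<and>
      [lucas_U P Q (Suc i) = lucas_U P Q (Suc (i + d))] (mod int p)"
    by (simp add: s_def cong_def)
  then have "[lucas_U P Q d = 0] (mod int p)"
  proof (induction i)
    case 0
    then show ?case by (simp add: cong_sym)
  next
    case (Suc i)
    have *: "Q * lucas_U P Q j = P * lucas_U P Q (Suc j) - lucas_U P Q (Suc (Suc j))" for j
      by simp
    have "[Q * lucas_U P Q i = Q * lucas_U P Q (i + d)] (mod int p)"
      unfolding * using Suc.prems by (intro cong_diff cong_mult cong_refl) simp_all
    moreover have "coprime Q (int p)"
      using assms prime_imp_coprime coprime_commute by blast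
    ultimately have "[lucas_U P Q i = lucas_U P Q (i + d)] (mod int p)"
      by (simp add: cong_mult_lcancel)
    then show ?case using Suc by simp
  qed
  moreover from this have "d \<noteq> 1"
    using assms(1) not_prime_unit by (auto simp: cong_0_iff)
  ultimately show ?thesis
    using \<open>d > 0\<close> by (intro exI[of _ d]) (auto simp: cong_0_iff)
qed

section \<open>Expansion at multiples of an index\<close>

lemma lucas_U_dvd_mult: "lucas_U P Q n dvd lucas_U P Q (k * n)"
proof (induction k)
  case (Suc k)
  then show ?case using lucas_U_add[of P Q "k * n" n] by (simp add: add.commute)
qed simp

text \<open>The factor \<open>a\<^sup>2\<close> on both sides makes the exponents on the right non-negative.\<close>

lemma lucas_U_mult_cong:
  fixes P Q :: int and n :: nat
  defines "u \<equiv> lucas_U P Q n" and "a \<equiv> lucas_U P Q (Suc n) - P * lucas_U P Q n"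
  shows "[a\<^sup>2 * lucas_U P Q (k * n) =
    u * (int k * a ^ (k + 1) + int (k choose 2) * a ^ k * u * P)] (mod u ^ 3)"
proof -
  \<comment> \<open>Here \<open>\<alpha>^(k n) = W k + U_(k n) \<alpha>\<close>; the next two
    recursions express multiplication by \<open>\<alpha>^n = a + u \<alpha>\<close>.\<close>
  define W where "W k = lucas_U P Q (Suc (k * n)) - P * lucas_U P Q (k * n)" for k
  have U_Suc: "lucas_U P Q (Suc k * n) = lucas_U P Q (k * n) * (a + P * u) + u * W k" for k
    using lucas_U_add[of P Q "k * n" n] by (simp add: W_def a_def u_def add.commute)
  have W_Suc: "W (Suc k) = W k * a - Q * u * lucas_U P Q (k * n)" for k
  proof -
    have "W (Suc k) = lucas_U P Q (Suc (k * n + n)) - P * lucas_U P Q (k * n + n)"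
      by (simp add: W_def add.commute)
    then show ?thesis
      unfolding lucas_U_add_Suc lucas_U_add by (simp add: W_def a_def u_def algebra_simps)
  qed
  have dvd_U: "u dvd lucas_U P Q (k * n)" for k
    unfolding u_def by (rule lucas_U_dvd_mult)
  \<comment> \<open>Precision \<open>u^2\<close> suffices, since \<open>W k\<close> enters
    \<open>U_Suc\<close> with a factor \<open>u\<close>.\<close>
  have W_cong: "[W k = a ^ k] (mod u\<^sup>2)" for k
  proof (induction k)
    case 0
    then show ?case by (simp add: W_def)
  next
    case (Suc k)
    have "[Q * u * lucas_U P Q (k * n) = 0] (mod u\<^sup>2)"
      using dvd_U[of k] by (auto simp: cong_0_iff power2_eq_square intro: mult_dvd_mono)
    with Suc have "[W k * a - Q * u * lucas_U P Q (k * n) = a ^ k * a - 0] (mod u\<^sup>2)"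
      by (intro cong_diff cong_mult cong_refl)
    then show ?case by (simp add: W_Suc mult.commute)
  qed
  show ?thesis
  proof (induction k)
    case (Suc k)
    obtain w where w: "W k = a ^ k + u\<^sup>2 * w"
      using W_cong[of k] by (metis cong_iff_lin cong_sym)
    obtain z where z: "a\<^sup>2 * lucas_U P Q (k * n) =
        u * (int k * a ^ (k + 1) + int (k choose 2) * a ^ k * u * P) + u ^ 3 * z"
      using Suc by (metis cong_iff_lin cong_sym)
    have choose: "int (Suc k choose 2) = int k + int (k choose 2)"
      by (simp add: numeral_2_eq_2)
    have "a\<^sup>2 * lucas_U P Q (Suc k * n) =
        (a\<^sup>2 * lucas_U P Q (k * n)) * (a + P * u) + a\<^sup>2 * u * W k"
      by (simp only: U_Suc) (simp add: algebra_simps)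
    also have "\<dots> = u * (int (Suc k) * a ^ (Suc k + 1)
          + int (Suc k choose 2) * a ^ Suc k * u * P)
        + u ^ 3 * (z * (a + P * u) + int (k choose 2) * a ^ k * P\<^sup>2 + a\<^sup>2 * w)"
      unfolding z w choose by (simp add: algebra_simps power2_eq_square power3_eq_cube)
    finally show ?case by (simp add: cong_def)
  qed (simp add: binomial_eq_0)
qed

text \<open>Cancelling \<open>u\<close> in the expansion leaves an equation for the quotient
  \<open>t\<close>, whose valuation can be read off because \<open>a\<close>, congruent to
  \<open>lucas_U P Q (Suc n)\<close> modulo \<open>p\<close>, is a unit there.\<close>

lemma lucas_U_mult_quotient:
  fixes p n :: nat
  assumes "prime (int p)" "\<not> int p dvd Q" "int p dvd lucas_U P Q n" "lucas_U P Q n \<noteq> 0"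
  obtains a t z where "\<not> int p dvd a" "lucas_U P Q (k * n) = lucas_U P Q n * t"
    "a\<^sup>2 * t = int k * a ^ (k + 1) + int (k choose 2) * a ^ k * lucas_U P Q n * P
      + (lucas_U P Q n)\<^sup>2 * z"
proof -
  define u a where "u = lucas_U P Q n" and "a = lucas_U P Q (Suc n) - P * lucas_U P Q n"
  obtain t where t: "lucas_U P Q (k * n) = u * t"
    using lucas_U_dvd_mult[of P Q n k] by (auto simp: u_def)
  obtain z where "a\<^sup>2 * lucas_U P Q (k * n) =
      u * (int k * a ^ (k + 1) + int (k choose 2) * a ^ k * u * P) + u ^ 3 * z"
    using lucas_U_mult_cong[of P Q n k] unfolding u_def a_def by (metis cong_iff_lin cong_sym)
  then have "u * (a\<^sup>2 * t) =
      u * (int k * a ^ (k + 1) + int (k choose 2) * a ^ k * u * P + u\<^sup>2 * z)"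
    by (simp add: t algebra_simps power2_eq_square power3_eq_cube)
  then have "a\<^sup>2 * t = int k * a ^ (k + 1) + int (k choose 2) * a ^ k * u * P + u\<^sup>2 * z"
    using assms(4) by (simp add: u_def)
  moreover have "\<not> int p dvd a"
    using prime_not_dvd_consecutive_lucas_U[OF assms(1-3)] assms(3)
    by (simp add: a_def dvd_diff_left_iff)
  ultimately show ?thesis using t unfolding u_def by (blast intro: that)
qed

section \<open>Valuations at multiples of an index\<close>

text \<open>Only the leading term \<open>k * a ^ (k + 1)\<close> survives modulo \<open>p\<close>.
  Stating a factorization instead of a valuation includes the case \<open>U_n = 0\<close>.\<close>

lemma lucas_U_mult_coprime:
  assumes "prime (int p)" "\<not> int p dvd Q" "int p dvd lucas_U P Q n" "\<not> p dvd k"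
  shows "\<exists>t. \<not> int p dvd t \<and> lucas_U P Q (k * n) = lucas_U P Q n * t"
proof (cases "lucas_U P Q n = 0")
  case True
  then show ?thesis
    using assms(1) not_prime_unit lucas_U_dvd_mult[of P Q n k] by (intro exI[of _ 1]) auto
next
  case False
  obtain a t z where a: "\<not> int p dvd a" and t: "lucas_U P Q (k * n) = lucas_U P Q n * t"
    and eq: "a\<^sup>2 * t = int k * a ^ (k + 1) + int (k choose 2) * a ^ k * lucas_U P Q n * P
      + (lucas_U P Q n)\<^sup>2 * z"
    using lucas_U_mult_quotient[OF assms(1-3) False, where k = k] by blast
  have "\<not> int p dvd t"
  proof
    assume "int p dvd t"
    then have "int p dvd a\<^sup>2 * t" by simp
    moreover have "int p dvd int (k choose 2) * a ^ k * lucas_U P Q n * P"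
      "int p dvd (lucas_U P Q n)\<^sup>2 * z"
      using assms(3) by (simp_all add: power2_eq_square)
    ultimately have "int p dvd int k * a ^ (k + 1)"
      unfolding eq by (simp add: dvd_add_left_iff)
    then show False
      using a assms(1,4) by (metis prime_dvd_mult_iff prime_dvd_power int_dvd_int_iff)
  qed
  with t show ?thesis by blast
qed

text \<open>For \<open>k = p\<close> the leading term has valuation exactly 1, and the other two are
  divisible by \<open>p^2\<close>. The last hypothesis secures this for the middle term, which would
  fail for \<open>p = 2\<close>, \<open>P\<close> odd and \<open>U_n\<close> congruent to 2 modulo
  4.\<close>

lemma lucas_U_mult_prime:
  assumes "prime (int p)" "\<not> int p dvd Q" "int p dvd lucas_U P Q n"
    and "odd p \<or> even P \<or> 4 dvd lucas_U P Q n"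
  shows "\<exists>t. \<not> int p dvd t \<and> lucas_U P Q (p * n) = lucas_U P Q n * int p * t"
proof (cases "lucas_U P Q n = 0")
  case True
  then show ?thesis
    using assms(1) not_prime_unit lucas_U_dvd_mult[of P Q n p] by (intro exI[of _ 1]) auto
next
  case False
  define u where "u = lucas_U P Q n"
  obtain a t z where a: "\<not> int p dvd a" and t: "lucas_U P Q (p * n) = u * t"
    and eq: "a\<^sup>2 * t = int p * a ^ (p + 1) + int (p choose 2) * a ^ p * u * P + u\<^sup>2 * z"
    using lucas_U_mult_quotient[OF assms(1-3) False, where k = p] unfolding u_def by blast
  \<comment> \<open>For odd \<open>p\<close> one factor comes from the binomial coefficient and one
    from \<open>u\<close>; for \<open>p = 2\<close> the coefficient is 1 and \<open>u * P\<close>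
    must supply both.\<close>
  have "int p * int p dvd int (p choose 2) * (u * P)"
  proof (cases "odd p")
    case True
    then have "p choose 2 = p * ((p - 1) div 2)"
      by (simp add: choose_two div_mult_swap)
    then have "int p dvd int (p choose 2)" by simp
    moreover have "int p dvd u * P" using assms(3) by (simp add: u_def)
    ultimately show ?thesis by (rule mult_dvd_mono)
  next
    case False
    then have "p = 2"
      using assms(1) prime_odd_nat[of p] prime_ge_2_nat[of p] by fastforce
    moreover have "4 dvd u * P"
    proof (cases "even P")
      case True
      then have "2 * 2 dvd u * P"
        using assms(3) \<open>p = 2\<close> by (intro mult_dvd_mono) (simp_all add: u_def)
      then show ?thesis by simp
    next
      case False
      then show ?thesis using assms(4) \<open>\<not> odd p\<close> by (auto simp: u_def)
    qed
    ultimately show ?thesis by simp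
  qed
  moreover have "int p * int p dvd u\<^sup>2"
    using assms(3) by (simp add: u_def power2_eq_square mult_dvd_mono)
  ultimately obtain x y where x: "int (p choose 2) * (u * P) = int p * int p * x"
    and y: "u\<^sup>2 = int p * int p * y" by (elim dvdE)
  have "int (p choose 2) * a ^ p * u * P = a ^ p * (int p * int p * x)"
    unfolding x[symmetric] by (simp add: ac_simps)
  then have eq': "a\<^sup>2 * t = int p * (a ^ (p + 1) + int p * (a ^ p * x + y * z))"
    unfolding eq y by (simp add: algebra_simps)
  have a2: "\<not> int p dvd a\<^sup>2" using a assms(1) prime_dvd_power by blast
  have "int p dvd a\<^sup>2 * t" unfolding eq' by simp
  then obtain s where s: "t = int p * s"
    using a2 assms(1) prime_dvd_mult_iff by (metis dvdE)
  have p0: "int p \<noteq> 0" using assms(1) by auto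
  have "a\<^sup>2 * s = a ^ (p + 1) + int p * (a ^ p * x + y * z)"
    using eq' p0 unfolding s by (simp add: mult.left_commute)
  moreover have "\<not> int p dvd a ^ (p + 1)" using a assms(1) prime_dvd_power by blast
  ultimately have "\<not> int p dvd a\<^sup>2 * s" by (simp add: dvd_add_left_iff del: power_Suc)
  then have "\<not> int p dvd s" using dvd_mult by blast
  with t s show ?thesis by (auto simp: u_def)
qed

lemma lucas_U_mult_prime_power:
  assumes "prime (int p)" "\<not> int p dvd Q" "int p dvd lucas_U P Q n"
    and "odd p \<or> even P \<or> 4 dvd lucas_U P Q n"
  shows "\<exists>t. \<not> int p dvd t \<and> lucas_U P Q (p ^ j * n) = lucas_U P Q n * int p ^ j * t"
proof (induction j)
  case 0
  then show ?case using assms(1) not_prime_unit by (intro exI[of _ 1]) auto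
next
  case (Suc j)
  \<comment> \<open>Through this divisibility the hypotheses on \<open>n\<close> pass to
    \<open>p ^ j * n\<close>.\<close>
  have dvd: "lucas_U P Q n dvd lucas_U P Q (p ^ j * n)" by (rule lucas_U_dvd_mult)
  obtain s where "\<not> int p dvd s"
    "lucas_U P Q (p ^ j * n) = lucas_U P Q n * int p ^ j * s"
    using Suc by blast
  moreover obtain t where "\<not> int p dvd t"
    "lucas_U P Q (p * (p ^ j * n)) = lucas_U P Q (p ^ j * n) * int p * t"
    using lucas_U_mult_prime[of p Q P "p ^ j * n"] assms dvd dvd_trans by meson
  ultimately show ?case
    using assms(1) by (intro exI[of _ "s * t"]) (simp add: prime_dvd_mult_iff ac_simps)
qed

lemma lucas_U_mult_multiplicity:
  assumes "prime (int p)" "\<not> int p dvd Q" "int p dvd lucas_U P Q n"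
    and "odd p \<or> even P \<or> 4 dvd lucas_U P Q n" and "m > 0"
  shows "\<exists>t. \<not> int p dvd t \<and> lucas_U P Q (m * n) = lucas_U P Q n * int p ^ multiplicity p m * t"
proof -
  define j where "j = multiplicity p m"
  have "m \<noteq> 0" "\<not> is_unit p" using assms(1,5) not_prime_unit by auto
  then obtain k where m: "m = p ^ j * k" and k: "\<not> p dvd k"
    unfolding j_def by (rule multiplicity_decompose')
  have "lucas_U P Q n dvd lucas_U P Q (p ^ j * n)" by (rule lucas_U_dvd_mult)
  then obtain t where "\<not> int p dvd t"
    "lucas_U P Q (k * (p ^ j * n)) = lucas_U P Q (p ^ j * n) * t"
    using lucas_U_mult_coprime[of p Q P "p ^ j * n" k] assms k dvd_trans by meson
  moreover obtain s where "\<not> int p dvd s"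
    "lucas_U P Q (p ^ j * n) = lucas_U P Q n * int p ^ j * s"
    using lucas_U_mult_prime_power[OF assms(1-4)] by blast
  ultimately show ?thesis
    unfolding j_def[symmetric] unfolding m using assms(1)
    by (intro exI[of _ "s * t"]) (simp add: prime_dvd_mult_iff ac_simps)
qed

lemma prime_power_dvd_lucas_U_mult:
  assumes "prime (int p)" "\<not> int p dvd Q" "int p dvd lucas_U P Q n"
    and "odd p \<or> even P \<or> 4 dvd lucas_U P Q n"
  shows "int p ^ r dvd lucas_U P Q (m * n) \<longleftrightarrow> p ^ pos_diff r (val p (lucas_U P Q n)) dvd m"
proof (cases "m = 0 \<or> lucas_U P Q n = 0")
  \<comment> \<open>Both sides hold: \<open>U_(m n) = 0\<close>, while either \<open>m = 0\<close>
    or the valuation is \<infinity> and the exponent on the right is 0.\<close>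
  case True
  then show ?thesis
    using lucas_U_dvd_mult[of P Q n m] by (auto simp: val_def pos_diff_def zero_enat_def)
next
  case False
  define v j where "v = multiplicity (int p) (lucas_U P Q n)" and "j = multiplicity p m"
  obtain t where t: "\<not> int p dvd t" "lucas_U P Q (m * n) = lucas_U P Q n * int p ^ j * t"
    using lucas_U_mult_multiplicity[OF assms, of m] False by (auto simp: j_def)
  have p: "prime_elem (int p)" "int p \<noteq> 0" "\<not> is_unit (int p)" "\<not> is_unit p"
    using assms(1) not_prime_unit by auto
  have t0: "t \<noteq> 0" using t(1) by auto
  have "int p ^ r dvd lucas_U P Q (m * n) \<longleftrightarrow>
      r \<le> multiplicity (int p) (lucas_U P Q n * int p ^ j * t)"
    unfolding t(2) using p False t0 by (subst power_dvd_iff_le_multiplicity) auto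
  also have "multiplicity (int p) (lucas_U P Q n * int p ^ j * t) = v + j"
    using p False t0 t(1)
    by (simp add: prime_elem_multiplicity_mult_distrib v_def not_dvd_imp_multiplicity_0)
  also have "r \<le> v + j \<longleftrightarrow> r - v \<le> j" by linarith
  also have "\<dots> \<longleftrightarrow> p ^ (r - v) dvd m"
    using p False by (subst power_dvd_iff_le_multiplicity) (auto simp: j_def)
  also have "r - v = pos_diff r (val p (lucas_U P Q n))"
    using False by (simp add: pos_diff_def val_def v_def)
  finally show ?thesis .
qed

section \<open>From divisibility to generated semigroups\<close>

lemma generated_semigroup_singleton: "generated_semigroup {x} = {n. x dvd n}"
  unfolding generated_semigroup_def
proof (rule hull_unique)
  show "{x} \<subseteq> {n. x dvd n}" by simp
  show "add_semigroup {n. x dvd n}" by (simp add: add_semigroup_def)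
  fix S assume S: "{x} \<subseteq> S" "add_semigroup S"
  have "x * k \<in> S" for k
    using S by (induction k) (simp_all add: add_semigroup_def)
  then show "{n. x dvd n} \<subseteq> S" by auto
qed

lemma lucas_set_inverse_power:
  assumes "p > 0"
  shows "lucas_set P Q (1 / of_nat p ^ r) = {n. int p ^ r dvd lucas_U P Q n}"
proof -
  have "of_int x * (1 / of_nat p ^ r) \<in> (\<int> :: rat set) \<longleftrightarrow> int p ^ r dvd x" for x
  proof -
    have "of_int x * (1 / of_nat p ^ r) = (of_int x / of_int (int p ^ r) :: rat)" by simp
    also have "\<dots> \<in> \<int> \<longleftrightarrow> int p ^ r dvd x"
      using assms by (subst of_int_div_of_int_in_Ints_iff) auto
    finally show ?thesis .
  qed
  then show ?thesis by (simp add: lucas_set_def)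
qed

text \<open>Reduces a case of the theorem to a choice of \<open>n\<close>: once all indices in the
  set are multiples of \<open>n\<close>, the valuation criterion decides which cofactors
  occur.\<close>

lemma lucas_set_eq_generated:
  assumes "prime (int p)" "\<not> int p dvd Q" "int p dvd lucas_U P Q n"
    and "odd p \<or> even P \<or> 4 dvd lucas_U P Q n"
    and "\<And>i. int p ^ r dvd lucas_U P Q i \<Longrightarrow> n dvd i"
  shows "lucas_set P Q (1 / of_nat p ^ r) =
    generated_semigroup {p ^ pos_diff r (val p (lucas_U P Q n)) * n}"
proof -
  have "int p ^ r dvd lucas_U P Q i \<longleftrightarrow> p ^ pos_diff r (val p (lucas_U P Q n)) * n dvd i" for i
  proof (cases "n dvd i")
    case True
    then obtain m where i: "i = m * n" by (metis dvdE mult.commute)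
    show ?thesis
    proof (cases "n = 0")
      case False
      then show ?thesis unfolding i using prime_power_dvd_lucas_U_mult[OF assms(1-4)] by simp
    qed (simp add: i)
  next
    case False
    then show ?thesis using assms(5) dvd_mult_right by blast
  qed
  moreover have "p > 0" using assms(1) by (simp add: prime_gt_0_nat)
  ultimately show ?thesis
    by (simp add: lucas_set_inverse_power generated_semigroup_singleton)
qed

section \<open>Starting indices\<close>

text \<open>By periodicity \<open>i\<close> may be reduced modulo the rank, and below the rank only
  index 0 gives a multiple of \<open>p\<close>.\<close>

lemma prime_dvd_lucas_U_iff_rank:
  assumes "prime (int p)" "\<not> int p dvd Q"
  shows "int p dvd lucas_U P Q i \<longleftrightarrow> rank_of_appearance P Q p dvd i"
proof -
  define \<rho> where "\<rho> = rank_of_appearance P Q p"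
  have rho: "2 \<le> \<rho>" "int p dvd lucas_U P Q \<rho>"
    using LeastI_ex[OF exists_prime_dvd_lucas_U[OF assms, of P]]
    by (simp_all add: \<rho>_def rank_of_appearance_def)
  have "int p dvd lucas_U P Q j \<longleftrightarrow> j = 0" if "j < \<rho>" for j
  proof (cases "2 \<le> j")
    case True
    then show ?thesis
      using not_less_Least[of j] that unfolding \<rho>_def rank_of_appearance_def by auto
  next
    case False
    then have "j = 0 \<or> j = Suc 0" by auto
    then show ?thesis using assms(1) not_prime_unit by auto
  qed
  from this[of "i mod \<rho>"] show ?thesis
    using rho prime_dvd_lucas_U_mod[OF assms rho(2), of i] by (auto simp: \<rho>_def dvd_eq_mod_eq_0)
qed

text \<open>Uses \<open>U_2 = P\<close> and \<open>U_3 = P^2 - Q\<close>.\<close>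

lemma rank_of_appearance_2:
  assumes "odd Q"
  shows "rank_of_appearance P Q 2 = (if even P then 2 else 3)"
proof -
  have "rank_of_appearance P Q 2 = 3" if "odd P"
    unfolding rank_of_appearance_def
  proof (rule Least_equality)
    fix y assume y: "2 \<le> y \<and> int 2 dvd lucas_U P Q y"
    have "y \<noteq> 2" using y that by (auto simp: numeral_2_eq_2)
    with y show "3 \<le> y" by linarith
  qed (use assms that in \<open>auto simp: numeral_3_eq_3\<close>)
  moreover have "rank_of_appearance P Q 2 = 2" if "even P"
    unfolding rank_of_appearance_def
    by (rule Least_equality) (use that in \<open>auto simp: numeral_2_eq_2\<close>)
  ultimately show ?thesis by simp
qed

lemma odd_square_mod_4:
  assumes "odd (P :: int)"
  shows "P\<^sup>2 mod 4 = 1"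
proof -
  obtain b where "P = 2 * b + 1" using assms by (rule oddE)
  then have "P\<^sup>2 = 4 * (b\<^sup>2 + b) + 1" by (simp add: power2_eq_square algebra_simps)
  then show ?thesis by presburger
qed

text \<open>Separates the cases with \<open>P\<close> and \<open>Q\<close> odd: index 3 satisfies
  the condition \<open>4 dvd U_n\<close> if \<open>Q\<close> is 1 modulo 4, whereas
  \<open>U_3\<close> has 2-adic valuation exactly 1 if \<open>Q\<close> is -1.\<close>

lemma lucas_U_3_mod_4:
  assumes "odd P"
  shows "lucas_U P Q 3 mod 4 = (1 - Q) mod 4"
proof -
  have "lucas_U P Q 3 = P\<^sup>2 - Q" by (simp add: numeral_3_eq_3 power2_eq_square)
  then show ?thesis using odd_square_mod_4[OF assms] by (metis mod_diff_left_eq)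
qed

lemma four_dvd_lucas_U_6:
  assumes "odd P" "[Q = -1] (mod 4)"
  shows "4 dvd lucas_U P Q 6"
proof -
  \<comment> \<open>This is \<open>U_6 = U_3 V_3\<close> with the companion Lucas number
    \<open>V_3 = P (P^2 - 3 Q)\<close>.\<close>
  have eq: "lucas_U P Q 6 = P * lucas_U P Q 3 * (P\<^sup>2 - 3 * Q)"
    by (simp add: eval_nat_numeral algebra_simps)
  have "lucas_U P Q 3 mod 4 = (1 - Q) mod 4" using lucas_U_3_mod_4[OF assms(1)] .
  then have "2 dvd lucas_U P Q 3" using assms(2) unfolding cong_def by presburger
  moreover have "4 dvd P\<^sup>2 - 3 * Q"
    using odd_square_mod_4[OF assms(1)] assms(2) unfolding cong_def by presburger
  ultimately show ?thesis unfolding eq by (meson dvd_mult)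
qed

text \<open>The rank of 2 is 3, and an odd multiple of 3 keeps the valuation of \<open>U_3\<close>,
  which is 1.\<close>

lemma six_dvd_if_four_dvd_lucas_U:
  assumes "odd P" "[Q = -1] (mod 4)" "4 dvd lucas_U P Q i"
  shows "6 dvd i"
proof -
  have Q: "odd Q" using assms(2) unfolding cong_def by presburger
  have "2 dvd lucas_U P Q i" using assms(3) by (rule dvd_trans[rotated]) simp
  then have "3 dvd i"
    using prime_dvd_lucas_U_iff_rank[of 2 Q P i] Q rank_of_appearance_2[OF Q] assms(1) by simp
  then obtain k where i: "i = k * 3" by (metis dvdE mult.commute)
  have U3: "\<not> 4 dvd lucas_U P Q 3" "2 dvd lucas_U P Q 3"
    using lucas_U_3_mod_4[OF assms(1), of Q] assms(2) unfolding cong_def by presburger+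
  have "even k"
  proof (rule ccontr)
    assume "odd k"
    then obtain t where "odd t" "lucas_U P Q i = lucas_U P Q 3 * t"
      using lucas_U_mult_coprime[of 2 Q P 3 k] Q U3(2) unfolding i by auto
    moreover have "coprime 4 t"
      using \<open>odd t\<close> coprime_power_left_iff[of 2 2 t] by simp
    ultimately show False
      using assms(3) U3(1) by (simp add: coprime_dvd_mult_left_iff)
  qed
  then show ?thesis unfolding i by presburger
qed

section \<open>The case of \<open>p\<close> dividing \<open>Q\<close>, and the case
  distinction\<close>

text \<open>Modulo \<open>p\<close> the recurrence becomes multiplication by the unit
  \<open>P\<close>.\<close>

lemma prime_not_dvd_lucas_U:
  assumes "prime p" "p dvd Q" "\<not> p dvd P"
  shows "\<not> p dvd lucas_U P Q (Suc n)"
proof (induction n)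
  case 0
  then show ?case using assms(1) not_prime_unit by auto
next
  case (Suc n)
  then show ?case using assms by (simp add: dvd_diff_left_iff prime_dvd_mult_iff)
qed

theorem theorem4p1:
  fixes P Q :: int and p r :: nat
  assumes "P * Q \<noteq> 0"
    and "prime p"
    and "\<not> int p dvd gcd P Q"
    and "1 \<le> r"
  defines "L \<equiv> lucas_set P Q (1 / of_nat p ^ r)"
  shows "(int p dvd Q \<longrightarrow> L = {0})
    \<and> (3 \<le> p \<and> \<not> int p dvd Q \<longrightarrow>
        L = generated_semigroup
              {p ^ pos_diff r (rank_exponent P Q p) * rank_of_appearance P Q p})
    \<and> (p = 2 \<and> 2 dvd P \<and> \<not> 2 dvd Q \<longrightarrow>
        L = generated_semigroup {2 ^ (1 + pos_diff r (val 2 P))})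
    \<and> (p = 2 \<and> \<not> 2 dvd P \<and> \<not> 2 dvd Q \<and> [Q = 1] (mod 4) \<longrightarrow>
        L = generated_semigroup {3 * 2 ^ pos_diff r (val 2 (lucas_U P Q 3))})
    \<and> (p = 2 \<and> \<not> 2 dvd P \<and> \<not> 2 dvd Q \<and> [Q = -1] (mod 4) \<and> r = 1 \<longrightarrow>
        L = generated_semigroup {3})
    \<and> (p = 2 \<and> \<not> 2 dvd P \<and> \<not> 2 dvd Q \<and> [Q = -1] (mod 4) \<and> r \<noteq> 1 \<longrightarrow>
        L = generated_semigroup {6 * 2 ^ pos_diff r (val 2 (lucas_U P Q 6))})"
proof -
  have prime: "prime (int p)" using assms(2) by simp
  have L: "L = {n. int p ^ r dvd lucas_U P Q n}"
    unfolding L_def using assms(2) by (intro lucas_set_inverse_power) (simp add: prime_gt_0_nat)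
  have p_dvd: "int p dvd x" if "int p ^ r dvd x" for x
    using that assms(4) by (metis dvd_power dvd_trans zero_less_one less_le_trans)
  have rank_dvd: "rank_of_appearance P Q p dvd i"
    if "\<not> int p dvd Q" "int p ^ r dvd lucas_U P Q i" for i
    using prime_dvd_lucas_U_iff_rank[OF prime that(1)] p_dvd[OF that(2)] by blast
  show ?thesis
  proof (intro conjI impI; (elim conjE)?)
    assume Q: "int p dvd Q"
    then have "\<not> int p dvd P" using assms(3) by simp
    then have "\<not> int p ^ r dvd lucas_U P Q (Suc n)" for n
      using prime_not_dvd_lucas_U[OF prime Q] p_dvd by blast
    then show "L = {0}" unfolding L
      by (auto simp: gr0_conv_Suc) (metis not0_implies_Suc)
  next
    assume p: "3 \<le> p" and Q: "\<not> int p dvd Q"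
    have "odd p" using p assms(2) prime_odd_nat by auto
    then show "L = generated_semigroup
        {p ^ pos_diff r (rank_exponent P Q p) * rank_of_appearance P Q p}"
      unfolding L_def rank_exponent_def using rank_dvd Q prime_dvd_lucas_U_iff_rank[OF prime Q]
      by (intro lucas_set_eq_generated prime) auto
  next
    assume p: "p = 2" and P: "2 dvd P" and Q: "\<not> 2 dvd Q"
    have U2: "lucas_U P Q 2 = P" by (simp add: numeral_2_eq_2)
    have "L = generated_semigroup {p ^ pos_diff r (val p (lucas_U P Q 2)) * 2}"
      unfolding L_def using rank_dvd p P Q rank_of_appearance_2[OF Q] U2
      by (intro lucas_set_eq_generated prime) auto
    then show "L = generated_semigroup {2 ^ (1 + pos_diff r (val 2 P))}"
      by (simp add: p U2 mult.commute)
  next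
    assume p: "p = 2" and P: "\<not> 2 dvd P" and Q: "\<not> 2 dvd Q" "[Q = 1] (mod 4)"
    have U3: "4 dvd lucas_U P Q 3"
      using lucas_U_3_mod_4[OF P, of Q] Q(2) unfolding cong_def by presburger
    have "L = generated_semigroup {p ^ pos_diff r (val p (lucas_U P Q 3)) * 3}"
      unfolding L_def using rank_dvd p P Q rank_of_appearance_2[OF Q(1)] U3
      by (intro lucas_set_eq_generated prime) auto
    then show "L = generated_semigroup {3 * 2 ^ pos_diff r (val 2 (lucas_U P Q 3))}"
      by (simp add: p mult.commute)
  next
    assume "p = 2" "\<not> 2 dvd P" "\<not> 2 dvd Q" "r = 1"
    then show "L = generated_semigroup {3}"
      unfolding L generated_semigroup_singleton
      using prime_dvd_lucas_U_iff_rank[OF prime] rank_of_appearance_2[of Q P] by simp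
  next
    assume p: "p = 2" and P: "\<not> 2 dvd P" and Q: "\<not> 2 dvd Q" "[Q = -1] (mod 4)" and "r \<noteq> 1"
    \<comment> \<open>As \<open>r\<close> is at least 2, membership in \<open>L\<close> forces
      \<open>4 dvd U_i\<close> and hence \<open>6 dvd i\<close>, so 6 can serve as starting
      index.\<close>
    have "4 dvd int p ^ r"
      using \<open>r \<noteq> 1\<close> assms(4) p le_imp_power_dvd[of 2 r "2 :: int"] by simp
    then have "6 dvd i" if "int p ^ r dvd lucas_U P Q i" for i
      using six_dvd_if_four_dvd_lucas_U[OF P Q(2)] that dvd_trans by blast
    moreover have "4 dvd lucas_U P Q 6" using four_dvd_lucas_U_6[OF P Q(2)] .
    moreover from this have "2 dvd lucas_U P Q 6" by (rule dvd_trans[rotated]) simp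
    ultimately have "L = generated_semigroup {p ^ pos_diff r (val p (lucas_U P Q 6)) * 6}"
      unfolding L_def using p Q
      by (intro lucas_set_eq_generated prime) auto
    then show "L = generated_semigroup {6 * 2 ^ pos_diff r (val 2 (lucas_U P Q 6))}"
      by (simp add: p mult.commute)
  qed
qed

end
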